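(* The following series converges and $$\frac{1}{\pi} = \frac{18}{85}\sqrt{\frac{3}{85}} \sum_{n=0}^{+\infty} \frac{(6n)!}{(3n)!\,(n!)^3}\, \frac{8 + 7\times 19\, n}{255^{3n}}.$$ *)

theory Defs
  imports Complex_Main
begin

end

theory Submission
  imports
    Defs
    "HOL-Analysis.Infinite_Sum"
    "HOL-Analysis.Gamma_Function"
    "HOL-Analysis.Generalised_Binomial_Theorem"
    "HOL-Real_Asymp.Real_Asymp"
begin

text \<open>
The series is a transform of another series of Ramanujan,
\<open>\<Sum> (2n choose n)^3 (42n + 5) / 4096^n = 16 / \<pi>\<close>. Both belong to the same
quadratic irrationality \<open>\<tau> = i\<surd>7\<close>, at which \<open>j(\<tau>) = 255^3\<close>, so an algebraic
transformation of the underlying \<open>3F2\<close> functions relates them. The proof below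
stays with these functions and does not pass through modular forms.

The series with \<open>42n + 5\<close> (\<open>ramanujan_sums_42\<close>) is evaluated by a Wilf--Zeilberger pair
(\<open>wz_pair\<close>): a parameter \<open>k\<close> is inserted into the summand in such a way that the sum
over \<open>n\<close> does not depend on \<open>k\<close>, while for \<open>k \<rightarrow> \<infinity>\<close> only the term \<open>n = 0\<close>
survives, whose limit is given by the Wallis product.

The transformation (\<open>central_binomial_cubes_transformation\<close>) is, coefficient by coefficient, a
terminating Pfaff--Saalschuetz summation (\<open>choose_cubed_eq_sum_saalschuetz\<close>) that writes
\<open>(2n choose n)^3\<close> as a sum over \<open>m \<le> n/2\<close> of \<open>(6m)! / ((3m)! m!^3)\<close> times the
coefficient of \<open>y^(n - 2m)\<close> in \<open>(1 - 16y)^(-3m - 1/2)\<close>. Exchanging the order of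
summation and summing the binomial series gives the theorem at \<open>y = 1/4096\<close>.
\<close>

section \<open>A Wilf--Zeilberger evaluation of the series with \<open>42 n + 5\<close>\<close>

lemma wallis_pochhammer:
  "(\<lambda>k. (pochhammer (1/2) k / fact k :: real)\<^sup>2 * (2 * real k + 1)) \<longlonglongrightarrow> 2 / pi"
proof -
  have step: "(w * (real n + 1/2) / (real n + 1))\<^sup>2 * (2 * real n + 3)
      = w\<^sup>2 * (2 * real n + 1) * ((4 * (real n + 1)\<^sup>2 - 1) / (4 * (real n + 1)\<^sup>2))" for w n
  proof -
    have "real n + 1 \<noteq> 0" by linarith
    then show ?thesis by (simp add: divide_simps) algebra
  qed
  have eq: "(pochhammer (1/2) n / fact n :: real)\<^sup>2 * (2 * real n + 1)
      = inverse (\<Prod>k=1..n. (4 * real k ^ 2) / (4 * real k ^ 2 - 1))" for n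
  proof (induction n)
    case 0
    then show ?case by simp
  next
    case (Suc n)
    have "(pochhammer (1/2) (Suc n) / fact (Suc n) :: real)\<^sup>2 * (2 * real (Suc n) + 1)
        = (pochhammer (1/2) n / fact n * (real n + 1/2) / (real n + 1))\<^sup>2 * (2 * real n + 3)"
      by (simp add: pochhammer_Suc mult_ac add_ac)
    also have "\<dots> = (pochhammer (1/2) n / fact n)\<^sup>2 * (2 * real n + 1)
        * ((4 * (real n + 1)\<^sup>2 - 1) / (4 * (real n + 1)\<^sup>2))"
      by (rule step)
    also have "\<dots> = inverse (\<Prod>k=1..Suc n. (4 * real k ^ 2) / (4 * real k ^ 2 - 1))"
      unfolding Suc.IH by (simp add: add_ac inverse_eq_divide)
    finally show ?case .
  qed
  show ?thesis
    unfolding eq using tendsto_inverse[OF wallis] by simp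
qed

lemma fact_double_pochhammer:
  "fact (2 * n) = 4 ^ n * pochhammer (1/2) n * (fact n :: real)"
  by (simp add: fact_double power_mult)

text \<open>
Put \<open>H = wz_kernel\<close>. At \<open>k = 0\<close> it is the summand
\<open>(2n choose n)^3 / 4096^n\<close>. The shape of the extension to \<open>k > 0\<close> comes from
Dougall's \<open>5F4\<close> sum with parameters \<open>a = 1/2 + k\<close>, \<open>b = c = 1/2\<close>, \<open>d = a\<close>,
\<open>e \<rightarrow> -\<infinity>\<close>, accelerated by the contiguity shift
\<open>(a, b, c, d) \<mapsto> (a + 3, b + 1, c + 1, d + 1)\<close>. This shift yields the factors
\<open>(1/2)_n^4 (1/2 + k)_n^2 / ((2n)! (1 + k)_{2n}^2)\<close>; the value of the sum contributes
\<open>(1/2)_k^2 / k!^2\<close>, which merges with them into the expression below. The point of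
this choice of parameter is that all terms with \<open>n > 0\<close> die out as \<open>k\<close> grows.
\<close>
definition wz_kernel :: "nat \<Rightarrow> nat \<Rightarrow> real" where
  "wz_kernel n k = pochhammer (1/2) n ^ 4 * pochhammer (1/2) (n + k) ^ 2
     / (fact (2 * n) * fact (2 * n + k) ^ 2)"

text \<open>
The solution of a linear system: given the antidifference \<open>32 n H(n, k)\<close> in the direction
of \<open>n\<close>, it is the numerator for which \<open>wz_pair\<close> holds.
\<close>
definition wz_poly :: "real \<Rightarrow> real \<Rightarrow> real" where
  "wz_poly n k = (5 + 24 * k + 36 * k^2 + 16 * k^3) + (72 + 208 * k + 176 * k^2 + 32 * k^3) * n
     + (312 + 544 * k + 208 * k^2) * n^2 + (544 + 448 * k) * n^3 + 336 * n^4"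

definition wz_term :: "nat \<Rightarrow> nat \<Rightarrow> real" where
  "wz_term n k = wz_kernel n k * wz_poly (real n) (real k)
     / ((2 * real n + 1) * (2 * real n + real k + 1)^2)"

lemma wz_kernel_nonneg: "wz_kernel n k \<ge> 0"
  by (simp add: wz_kernel_def pochhammer_nonneg)

lemma wz_kernel_Suc_right:
  "wz_kernel n (Suc k) = wz_kernel n k * ((real n + real k + 1/2) / (2 * real n + real k + 1))^2"
  by (simp add: wz_kernel_def pochhammer_Suc power_mult_distrib power_divide add_ac mult_ac)

lemma wz_kernel_Suc_left:
  "wz_kernel (Suc n) k = wz_kernel n k * ((real n + 1/2)^4 * (real n + real k + 1/2)^2)
     / ((2 * real n + 1) * (2 * real n + 2)
         * ((2 * real n + real k + 1) * (2 * real n + real k + 2))^2)"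
  by (simp add: wz_kernel_def pochhammer_Suc power_mult_distrib power_divide add_ac mult_ac)

lemma wz_poly_identity:
  fixes n k :: real
  assumes "n \<ge> 0" "k \<ge> 0"
  shows "((n + k + 1/2) / (2 * n + k + 1))^2 * wz_poly n (k + 1) / ((2 * n + 1) * (2 * n + k + 2)^2)
      - wz_poly n k / ((2 * n + 1) * (2 * n + k + 1)^2)
      = 32 * (n + 1) * (((n + 1/2)^4 * (n + k + 1/2)^2)
          / ((2 * n + 1) * (2 * n + 2) * ((2 * n + k + 1) * (2 * n + k + 2))^2)) - 32 * n"
proof -
  have "2 * n + k + 1 \<noteq> 0" "2 * n + k + 2 \<noteq> 0" "2 * n + 1 \<noteq> 0" "2 * n + 2 \<noteq> 0"
    using assms by auto
  then show ?thesis
    unfolding wz_poly_def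
    by (simp add: divide_simps) algebra
qed

text \<open>
The Wilf--Zeilberger relation. Summing it over \<open>n < N\<close> leaves only a boundary term at
\<open>N\<close>, as \<open>n H(n, k)\<close> vanishes at \<open>n = 0\<close>.
\<close>
lemma wz_pair:
  "wz_term n (Suc k) - wz_term n k
     = 32 * real (Suc n) * wz_kernel (Suc n) k - 32 * real n * wz_kernel n k"
  using arg_cong[OF wz_poly_identity[of "real n" "real k"], of "\<lambda>x. wz_kernel n k * x"]
  by (simp add: wz_term_def wz_kernel_Suc_right wz_kernel_Suc_left algebra_simps)


lemma wz_kernel_0_right: "wz_kernel n 0 = real ((2 * n) choose n) ^ 3 / 4096 ^ n"
proof -
  have choose: "real ((2 * n) choose n) = 4 ^ n * pochhammer (1/2) n / fact n"
    by (simp add: binomial_fact fact_double_pochhammer)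
  have "(4096::real) ^ n = (4 ^ n) ^ 6"
    by (simp flip: power_mult add: mult.commute[of n]) (simp add: power_mult)
  moreover have "p ^ 4 * p\<^sup>2 / (q * p * f * (q * p * f)\<^sup>2) = (q * p / f) ^ 3 / q ^ 6"
    if "f \<noteq> 0" "q \<noteq> 0" for p q f :: real
    using that by (simp add: divide_simps eval_nat_numeral mult_ac)
  ultimately show ?thesis
    by (simp add: wz_kernel_def choose fact_double_pochhammer)
qed

lemma wz_term_0_right:
  "wz_term n 0 = real ((2 * n) choose n) ^ 3 * (42 * real n + 5) / 4096 ^ n"
proof -
  have "wz_poly (real n) 0 = (42 * real n + 5) * (2 * real n + 1) ^ 3"
    unfolding wz_poly_def by (simp add: algebra_simps) algebra
  then show ?thesis
    unfolding wz_term_def wz_kernel_0_right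
    by (simp add: divide_simps power3_eq_cube power2_eq_square)
qed

text \<open>
The only place where \<open>\<pi>\<close> enters: for \<open>n = 0\<close> the term is the Wallis product times a
rational function of \<open>k\<close> tending to \<open>8\<close>.
\<close>
lemma wz_term_0_left_limit: "(\<lambda>k. wz_term 0 k) \<longlonglongrightarrow> 16 / pi"
proof -
  define q where "q = (\<lambda>k::nat. wz_poly 0 (real k) / ((real k + 1)^2 * (2 * real k + 1)))"
  have "q \<longlonglongrightarrow> 8"
    unfolding q_def wz_poly_def by real_asymp
  from tendsto_mult[OF wallis_pochhammer this]
  have "(\<lambda>k. (pochhammer (1/2) k / fact k)\<^sup>2 * (2 * real k + 1) * q k) \<longlonglongrightarrow> 16 / pi"
    by simp
  moreover have "wz_term 0 k = (pochhammer (1/2) k / fact k)\<^sup>2 * (2 * real k + 1) * q k" for k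
    by (simp add: wz_term_def wz_kernel_def q_def power_divide add_ac)
  ultimately show ?thesis by simp
qed

lemma pochhammer_half_le_fact: "pochhammer (1/2) m \<le> (fact m :: real)"
proof (induction m)
  case (Suc m)
  have "pochhammer (1/2) m * (1/2 + real m) \<le> (fact m :: real) * (1 + real m)"
    using Suc by (intro mult_mono) (auto simp: pochhammer_nonneg)
  then show ?case by (simp add: pochhammer_Suc mult_ac add_ac)
qed auto

text \<open>
Since \<open>wz_poly\<close> is cubic in \<open>k\<close>, the factor next to the kernel grows only linearly, and
\<open>(1/2)_{n+k} \<le> (n + k)!\<close> against \<open>(2n + k)!\<close> makes the kernel decay
quadratically as soon as \<open>n > 0\<close>.
\<close>
lemma wz_term_limit:
  assumes "n > 0"
  shows "(\<lambda>k. wz_term n k) \<longlonglongrightarrow> 0"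
proof -
  define C :: real where "C = pochhammer (1/2) n ^ 4 / fact (2 * n)"
  define x where "x = real n"
  have x: "x \<ge> 0" by (simp add: x_def)
  have bound_limit: "(\<lambda>k. C / (real k + 1)^2 *
      (wz_poly x (real k) / ((2 * x + 1) * (2 * x + real k + 1)^2))) \<longlonglongrightarrow> 0"
    using x unfolding wz_poly_def by real_asymp
  have nonneg: "0 \<le> wz_term n k" for k
    by (simp add: wz_term_def wz_poly_def wz_kernel_nonneg)
  have "wz_term n k \<le> C / (real k + 1)^2 *
          (wz_poly x (real k) / ((2 * x + 1) * (2 * x + real k + 1)^2))" for k
  proof -
    have "(pochhammer (1/2) (n + k) :: real) * (real k + 1) \<le> fact (n + k) * (real (n + k) + 1)"
      by (intro mult_mono pochhammer_half_le_fact) auto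
    also have "\<dots> = fact (n + k + 1)" by (simp add: add_ac)
    also have "\<dots> \<le> fact (2 * n + k)"
      using assms by (intro fact_mono) auto
    finally have "pochhammer (1/2) (n + k) / fact (2 * n + k) \<le> 1 / (real k + 1)"
      by (simp add: field_simps)
    then have "(pochhammer (1/2) (n + k) / fact (2 * n + k)) ^ 2 \<le> (1 / (real k + 1)) ^ 2"
      by (intro power_mono) (auto simp: pochhammer_nonneg)
    then have "C * (pochhammer (1/2) (n + k) / fact (2 * n + k)) ^ 2 \<le> C * (1 / (real k + 1)) ^ 2"
      by (intro mult_left_mono) (auto simp: C_def pochhammer_nonneg)
    then have "wz_kernel n k \<le> C / (real k + 1)^2"
      by (simp add: wz_kernel_def C_def power_divide)
    then have "wz_kernel n k * (wz_poly x (real k) / ((2 * x + 1) * (2 * x + real k + 1)^2))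
       \<le> C / (real k + 1)^2 * (wz_poly x (real k) / ((2 * x + 1) * (2 * x + real k + 1)^2))"
      by (intro mult_right_mono) (auto simp: wz_poly_def x_def)
    then show ?thesis by (simp add: wz_term_def x_def)
  qed
  with nonneg show ?thesis
    by (intro tendsto_sandwich[OF _ _ tendsto_const bound_limit]) (auto intro: always_eventually)
qed

text \<open>
A majorant with a closed sum makes the accumulated boundary terms summable over \<open>k\<close>,
uniformly in the number of summands.
\<close>
lemma wz_kernel_telescope_bound:
  assumes "n > 0"
  shows "real n * wz_kernel n k
     \<le> (2 * real n + real k) * wz_kernel n k - (2 * real n + real (Suc k)) * wz_kernel n (Suc k)"
proof -
  define x y where "x = real n" and "y = real k"
  have xy: "x \<ge> 1" "y \<ge> 0" using assms by (auto simp: x_def y_def)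
  have "x * y \<ge> 0" "x * x \<ge> x * 1" using xy by (auto intro: mult_left_mono)
  then have "(x + y + 1/2)^2 \<le> (x + y) * (2 * x + y + 1)"
  proof -
    have "(x + y) * (2 * x + y + 1) - (x + y + 1/2)^2 = x * x + x * y - 1/4"
      by (simp add: power2_eq_square algebra_simps)
    then show ?thesis using \<open>x * y \<ge> 0\<close> \<open>x * x \<ge> x * 1\<close> xy by linarith
  qed
  then have "(x + y + 1/2)^2 / (2 * x + y + 1) \<le> x + y"
    using xy by (simp add: divide_le_eq)
  moreover have "(2 * x + y + 1) * ((x + y + 1/2) / (2 * x + y + 1))^2
      = (x + y + 1/2)^2 / (2 * x + y + 1)"
    using xy by (simp add: power2_eq_square)
  ultimately have "x \<le> (2 * x + y) - (2 * x + y + 1) * ((x + y + 1/2) / (2 * x + y + 1))^2"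
    by linarith
  from mult_right_mono[OF this wz_kernel_nonneg[of n k]] show ?thesis
    by (simp add: wz_kernel_Suc_right x_def y_def algebra_simps)
qed

lemma wz_partial_sum_shift:
  "(\<Sum>n<N. wz_term n k) = (\<Sum>n<N. wz_term n 0) + 32 * (\<Sum>j<k. real N * wz_kernel N j)"
proof (induction k)
  case (Suc k)
  have "(\<Sum>n<N. wz_term n (Suc k)) - (\<Sum>n<N. wz_term n k)
      = (\<Sum>n<N. 32 * real (Suc n) * wz_kernel (Suc n) k - 32 * real n * wz_kernel n k)"
    by (simp only: sum_subtractf[symmetric] wz_pair)
  also have "\<dots> = 32 * (real N * wz_kernel N k)"
    by (subst sum_lessThan_telescope) simp
  finally show ?case using Suc by (simp add: algebra_simps)
qed simp

text \<open>
For a fixed number \<open>N\<close> of terms, \<open>wz_partial_sum_shift\<close> compares the partial sum at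
\<open>k = 0\<close> with the one at \<open>k\<close>, which tends to \<open>16 / \<pi>\<close> as \<open>k \<rightarrow> \<infinity>\<close>. Taking
this limit before letting \<open>N\<close> grow means that only finite sums pass to the limit; the
defect is at most \<open>64 N H(N, 0) \<le> 64 N / 64^N\<close>.
\<close>
theorem ramanujan_sums_42:
  "(\<lambda>n. real ((2 * n) choose n) ^ 3 * (42 * real n + 5) / 4096 ^ n) sums (16 / pi)"
proof -
  define S where "S = (\<lambda>N. \<Sum>n<N. wz_term n 0)"
  have limit_k: "(\<lambda>k. \<Sum>n<Suc N. wz_term n k) \<longlonglongrightarrow> 16 / pi" for N
  proof -
    have "(\<lambda>k. wz_term 0 k + (\<Sum>n<N. wz_term (Suc n) k)) \<longlonglongrightarrow> 16 / pi + (\<Sum>n<N. 0)"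
      by (intro tendsto_add tendsto_sum wz_term_0_left_limit wz_term_limit) simp
    then show ?thesis unfolding sum.lessThan_Suc_shift by simp
  qed
  have tail: "(\<Sum>j<k. real N * wz_kernel N j) \<le> 2 * real N * wz_kernel N 0" if "N > 0" for N k
  proof -
    have "(\<Sum>j<k. real N * wz_kernel N j)
        \<le> (\<Sum>j<k. (2 * real N + real j) * wz_kernel N j
                 - (2 * real N + real (Suc j)) * wz_kernel N (Suc j))"
      by (intro sum_mono wz_kernel_telescope_bound that)
    also have "\<dots> = 2 * real N * wz_kernel N 0 - (2 * real N + real k) * wz_kernel N k"
      by (subst sum_lessThan_telescope') simp
    also have "\<dots> \<le> 2 * real N * wz_kernel N 0"
      using wz_kernel_nonneg[of N k] by simp
    finally show ?thesis .
  qed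
  have upper: "S (Suc N) \<le> 16 / pi" for N
  proof (rule tendsto_lowerbound[OF limit_k[of N]])
    have "S (Suc N) \<le> (\<Sum>n<Suc N. wz_term n k)" for k
    proof -
      have "0 \<le> (\<Sum>j<k. real (Suc N) * wz_kernel (Suc N) j)"
        by (intro sum_nonneg mult_nonneg_nonneg wz_kernel_nonneg) simp
      then show ?thesis
        using wz_partial_sum_shift[where N = "Suc N" and k = k] unfolding S_def by linarith
    qed
    then show "\<forall>\<^sub>F k in sequentially. S (Suc N) \<le> (\<Sum>n<Suc N. wz_term n k)"
      by (intro always_eventually allI)
  qed simp
  have lower: "16 / pi - 64 * real (Suc N) * wz_kernel (Suc N) 0 \<le> S (Suc N)" for N
  proof -
    have "16 / pi \<le> S (Suc N) + 64 * real (Suc N) * wz_kernel (Suc N) 0"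
    proof (rule tendsto_upperbound[OF limit_k[of N]])
      show "\<forall>\<^sub>F k in sequentially. (\<Sum>n<Suc N. wz_term n k)
              \<le> S (Suc N) + 64 * real (Suc N) * wz_kernel (Suc N) 0"
      proof (intro always_eventually allI)
        fix k
        show "(\<Sum>n<Suc N. wz_term n k) \<le> S (Suc N) + 64 * real (Suc N) * wz_kernel (Suc N) 0"
          using tail[of "Suc N" k] wz_partial_sum_shift[where N = "Suc N" and k = k] unfolding S_def by linarith
      qed
    qed simp
    then show ?thesis by linarith
  qed
  have kernel_le: "wz_kernel N 0 \<le> 1 / 64 ^ N" for N
  proof -
    have "real ((2 * N) choose N) \<le> 2 ^ (2 * N)"
      using binomial_le_pow2[of "2 * N" N] by (metis of_nat_le_iff of_nat_numeral of_nat_power)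
    then have "real ((2 * N) choose N) ^ 3 \<le> (2 ^ (2 * N)) ^ 3"
      by (intro power_mono) auto
    also have "((2::real) ^ (2 * N)) ^ 3 = 2 ^ (6 * N)"
      by (simp flip: power_mult)
    also have "\<dots> = (64::real) ^ N"
      by (simp add: power_mult)
    finally have "wz_kernel N 0 \<le> 64 ^ N / 4096 ^ N"
      by (simp add: wz_kernel_0_right divide_right_mono)
    also have "(64::real) ^ N / 4096 ^ N = 1 / 64 ^ N"
      by (simp flip: power_divide) (simp add: power_divide)
    finally show ?thesis .
  qed
  have "(\<lambda>N. S (Suc N)) \<longlonglongrightarrow> 16 / pi"
  proof (rule tendsto_sandwich[OF _ _ _ tendsto_const])
    show "(\<lambda>N. 16 / pi - 64 * real (Suc N) * (1 / 64 ^ Suc N)) \<longlonglongrightarrow> 16 / pi"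
      by real_asymp
    show "\<forall>\<^sub>F N in sequentially. 16 / pi - 64 * real (Suc N) * (1 / 64 ^ Suc N) \<le> S (Suc N)"
    proof (intro always_eventually allI)
      fix N
      have "64 * real (Suc N) * wz_kernel (Suc N) 0 \<le> 64 * real (Suc N) * (1 / 64 ^ Suc N)"
        by (intro mult_left_mono kernel_le) simp
      with lower[of N] show "16 / pi - 64 * real (Suc N) * (1 / 64 ^ Suc N) \<le> S (Suc N)"
        by linarith
    qed
    show "\<forall>\<^sub>F N in sequentially. S (Suc N) \<le> 16 / pi"
      using upper by simp
  qed
  then show ?thesis
    unfolding sums_def S_def wz_term_0_right by (rule LIMSEQ_imp_Suc)
qed

section \<open>Cubes of central binomial coefficients\<close>

text \<open>
\<open>rGamma\<close> stands for \<open>1 / (n - 2m)!\<close>. It vanishes when \<open>2m > n\<close>, so its functional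
equation holds across the boundary and the recurrence below needs no case distinction.
\<close>
definition saalschuetz_term :: "nat \<Rightarrow> nat \<Rightarrow> real" where
  "saalschuetz_term n m = 16 ^ n / 4 ^ m * pochhammer (1/2) (n + m)
     * rGamma (real n - 2 * real m + 1) / fact m ^ 3"

text \<open>
Zeilberger's algorithm: an antidifference in \<open>m\<close> for the recurrence operator of
\<open>(2n choose n)^3\<close> applied to \<open>saalschuetz_term\<close>.
\<close>
definition saalschuetz_cert :: "nat \<Rightarrow> nat \<Rightarrow> real" where
  "saalschuetz_cert n m = - 64 * (3 * real n + 2) * real m ^ 3 *
     (16 ^ n / 4 ^ m * pochhammer (1/2) (n + m) * rGamma (real n - 2 * real m + 2) / fact m ^ 3)"

lemma saalschuetz_certificate:
  "(real n + 1) ^ 3 * saalschuetz_term (Suc n) m - 8 * (2 * real n + 1) ^ 3 * saalschuetz_term n m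
     = saalschuetz_cert n (Suc m) - saalschuetz_cert n m"
proof -
  define x y where "x = real n" and "y = real m"
  define b where "b = 16 ^ n / 4 ^ m * pochhammer (1/2) (n + m) * rGamma (x - 2 * y + 2) / fact m ^ 3"
  have y: "y + 1 \<noteq> 0" by (simp add: y_def)
  have r1: "rGamma (x - 2 * y + 1) = (x - 2 * y + 1) * rGamma (x - 2 * y + 2)"
    using rGamma_plus1[of "x - 2 * y + 1"] by (simp add: add.assoc)
  have r0: "rGamma (x - 2 * y) = (x - 2 * y) * (x - 2 * y + 1) * rGamma (x - 2 * y + 2)"
    using rGamma_plus1[of "x - 2 * y"] r1 by simp
  have t0: "saalschuetz_term n m = (x - 2 * y + 1) * b"
    unfolding saalschuetz_term_def b_def r1[unfolded x_def y_def] x_def y_def by simp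
  have t1: "saalschuetz_term (Suc n) m = 16 * (x + y + 1/2) * b"
    unfolding saalschuetz_term_def b_def x_def y_def by (simp add: pochhammer_Suc add_ac mult_ac)
  have g0: "saalschuetz_cert n m = - 64 * (3 * x + 2) * y ^ 3 * b"
    unfolding saalschuetz_cert_def b_def x_def y_def by simp
  have "saalschuetz_cert n (Suc m) = - 64 * (3 * x + 2) * (y + 1) ^ 3 *
     (16 ^ n / (4 * 4 ^ m) * (pochhammer (1/2) (n + m) * (x + y + 1/2)) * rGamma (x - 2 * y)
       / ((y + 1) * fact m) ^ 3)"
    unfolding saalschuetz_cert_def x_def y_def by (simp add: pochhammer_Suc add_ac mult_ac)
  also have "\<dots> = - 16 * (3 * x + 2) * (x + y + 1/2) * (x - 2 * y) * (x - 2 * y + 1) * b"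
    unfolding r0 b_def using y by (simp add: divide_simps) algebra
  finally have g1: "saalschuetz_cert n (Suc m) = \<dots>" .
  show ?thesis
    unfolding t0 t1 g0 g1 unfolding x_def[symmetric] y_def[symmetric]
    by algebra
qed

lemma saalschuetz_term_eq_0: "n < 2 * m \<Longrightarrow> saalschuetz_term n m = 0"
  using rGamma_of_int[of "int n - 2 * int m + 1", where ?'a = real]
  by (simp add: saalschuetz_term_def)

text \<open>
An instance of the Pfaff--Saalschuetz sum: up to a factor depending only on \<open>n\<close>, the
right-hand side is the balanced series \<open>3F2(-n/2, (1-n)/2, n + 1/2; 1, 1; 1)\<close>, which terminates for either
parity of \<open>n\<close>. The certificate shows that it satisfies the same first-order recurrence as
\<open>(2n choose n)^3\<close>.
\<close>
lemma choose_cubed_eq_sum_saalschuetz: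
  "real ((2 * n) choose n) ^ 3 = (\<Sum>m\<le>n. saalschuetz_term n m)"
proof -
  define a where "a n = (\<Sum>m\<le>n. saalschuetz_term n m)" for n
  have rec_a: "(real n + 1) ^ 3 * a (Suc n) = 8 * (2 * real n + 1) ^ 3 * a n" for n
  proof -
    have "a n = (\<Sum>m\<le>Suc n. saalschuetz_term n m)"
      by (simp add: a_def saalschuetz_term_eq_0)
    then have "(real n + 1) ^ 3 * a (Suc n) - 8 * (2 * real n + 1) ^ 3 * a n
       = (\<Sum>m\<le>Suc n. (real n + 1) ^ 3 * saalschuetz_term (Suc n) m - 8 * (2 * real n + 1) ^ 3 * saalschuetz_term n m)"
      by (simp only: a_def sum_subtractf sum_distrib_left)
    also have "\<dots> = (\<Sum>m<Suc (Suc n). saalschuetz_cert n (Suc m) - saalschuetz_cert n m)"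
      by (simp only: saalschuetz_certificate lessThan_Suc_atMost)
    also have "\<dots> = saalschuetz_cert n (Suc (Suc n)) - saalschuetz_cert n 0"
      by (rule sum_lessThan_telescope)
    also have "\<dots> = 0"
      using rGamma_of_int[of "- int n - 2", where ?'a = real]
      by (simp add: saalschuetz_cert_def algebra_simps)
    finally show ?thesis by simp
  qed
  have rec_c: "(real n + 1) ^ 3 * real ((2 * Suc n) choose Suc n) ^ 3
      = 8 * (2 * real n + 1) ^ 3 * real ((2 * n) choose n) ^ 3" for n
  proof -
    have choose: "real ((2 * n) choose n) = 4 ^ n * pochhammer (1/2) n / fact n" for n
      by (simp add: binomial_fact fact_double_pochhammer)
    have "(real n + 1) * real ((2 * Suc n) choose Suc n) = 2 * (2 * real n + 1) * real ((2 * n) choose n)"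
    proof -
      have "real n + 1 \<noteq> 0" by linarith
      then show ?thesis
        unfolding choose by (simp add: pochhammer_Suc divide_simps) algebra
    qed
    from arg_cong[OF this, of "\<lambda>x. x ^ 3"] show ?thesis
      by (simp only: power_mult_distrib) simp
  qed
  have "real ((2 * n) choose n) ^ 3 = a n"
  proof (induction n)
    case 0
    then show ?case by (simp add: a_def saalschuetz_term_def)
  next
    case (Suc n)
    then have "(real n + 1) ^ 3 * real ((2 * Suc n) choose Suc n) ^ 3 = (real n + 1) ^ 3 * a (Suc n)"
      using rec_a[of n] rec_c[of n] by simp
    then show ?case
      by (simp only: mult_cancel_left) (auto simp: add_eq_0_iff)
  qed
  then show ?thesis by (simp add: a_def)
qed

definition ramanujan_coeff :: "nat \<Rightarrow> real" where
  "ramanujan_coeff m = fact (6 * m) / (fact (3 * m) * fact m ^ 3)"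

lemma ramanujan_coeff_pochhammer:
  "ramanujan_coeff m = 64 ^ m * pochhammer (1/2) (3 * m) / fact m ^ 3"
  using fact_double_pochhammer[of "3 * m"] by (simp add: ramanujan_coeff_def power_mult)

text \<open>
For fixed \<open>m\<close>, the terms are in \<open>k = n - 2m\<close> the coefficients of the binomial series
with exponent \<open>-(3m + 1/2)\<close>, which can be summed in closed form.
\<close>
lemma saalschuetz_term_shift:
  "saalschuetz_term (2 * m + k) m
     = ramanujan_coeff m * (16 ^ k * pochhammer (3 * real m + 1/2) k / fact k)"
proof -
  have r: "rGamma (real (2 * m + k) - 2 * real m + 1) = inverse (fact k)"
    using rGamma_of_int[of "int k + 1", where ?'a = real] by simp
  have p: "pochhammer (1/2) (2 * m + k + m)
      = pochhammer (1/2) (3 * m) * pochhammer (3 * real m + 1/2) k"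
    using pochhammer_product'[of "1/2 :: real" "3 * m" k] by (simp add: add_ac)
  have c: "(16::real) ^ (2 * m + k) / 4 ^ m = 64 ^ m * 16 ^ k"
  proof -
    have "(64::real) ^ m * 4 ^ m = 16 ^ m * 16 ^ m"
      by (simp flip: power_mult_distrib)
    then show ?thesis by (simp add: power_add power_mult power2_eq_square field_simps)
  qed
  show ?thesis
    unfolding saalschuetz_term_def ramanujan_coeff_pochhammer r p c
    by (simp add: inverse_eq_divide mult_ac)
qed

section \<open>Transformation of the series\<close>

lemma negative_binomial_affine_sums:
  fixes s z \<alpha> \<beta> :: real
  assumes "0 \<le> z" "z < 1"
  shows "(\<lambda>k. (\<alpha> + \<beta> * real k) * (pochhammer s k / fact k * z ^ k))
           sums ((\<alpha> + \<beta> * s * z / (1 - z)) * (1 - z) powr (- s))"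
proof -
  have binom: "(\<lambda>k. pochhammer s k / fact k * z ^ k) sums (1 - z) powr (- s)" for s
  proof -
    have "(- s gchoose k) * (- z) ^ k = pochhammer s k / fact k * z ^ k" for k
      by (simp add: gbinomial_pochhammer power_minus[of z])
    with gen_binomial_real[of "- z" "- s"] assms show ?thesis by simp
  qed
  have "(\<lambda>k. s * z * (pochhammer (s + 1) k / fact k * z ^ k)) sums (s * z * (1 - z) powr (- (s + 1)))"
    by (intro sums_mult binom)
  moreover have "s * z * (pochhammer (s + 1) k / fact k * z ^ k)
      = real (Suc k) * (pochhammer s (Suc k) / fact (Suc k) * z ^ Suc k)" for k
    by (simp add: pochhammer_rec divide_simps del: of_nat_Suc)
  ultimately have "(\<lambda>k. real (Suc k) * (pochhammer s (Suc k) / fact (Suc k) * z ^ Suc k))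
      sums (s * z * (1 - z) powr (- (s + 1)))"
    by (simp only:)
  from sums_Suc[OF this]
  have "(\<lambda>k. real k * (pochhammer s k / fact k * z ^ k)) sums (s * z * (1 - z) powr (- s - 1))"
    by simp
  from sums_add[OF sums_mult[OF binom, of \<alpha>] sums_mult[OF this, of \<beta>]]
  have "(\<lambda>k. \<alpha> * (pochhammer s k / fact k * z ^ k) + \<beta> * (real k * (pochhammer s k / fact k * z ^ k)))
     sums (\<alpha> * (1 - z) powr (- s) + \<beta> * (s * z * (1 - z) powr (- s - 1)))" .
  moreover have "(1 - z) powr (- s - 1) = (1 - z) powr (- s) / (1 - z)"
    using assms by (simp add: powr_diff)
  ultimately show ?thesis
    by (simp add: algebra_simps add_divide_distrib)
qed

text \<open>
With \<open>b = ramanujan_coeff\<close>, this encodes the transformation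
\<open>\<Sum> (2n choose n)^3 y^n = (1 - 16y)^(-1/2) \<Sum> b(m) (y^2 / (1 - 16y)^3)^m\<close> together
with its derivative: \<open>\<beta>\<close> weights the operator \<open>y d/dy\<close>. Handling both at once as a
rearrangement of a double series with nonnegative terms gives convergence of the right-hand
side for free and avoids differentiating power series.
\<close>
lemma central_binomial_cubes_transformation:
  fixes y \<alpha> \<beta> S :: real
  assumes y: "0 \<le> y" "16 * y < 1" and nonneg: "\<alpha> \<ge> 0" "\<beta> \<ge> 0"
    and sums: "(\<lambda>n. (\<alpha> + \<beta> * real n) * real ((2 * n) choose n) ^ 3 * y ^ n) sums S"
  shows "(\<lambda>m. ramanujan_coeff m * (y\<^sup>2 / (1 - 16 * y) ^ 3) ^ m *
             (\<alpha> + 2 * \<beta> * real m + \<beta> * (3 * real m + 1/2) * (16 * y) / (1 - 16 * y)))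
         sums (S * sqrt (1 - 16 * y))"
proof -
  define f where "f = (\<lambda>(n, m). (\<alpha> + \<beta> * real n) * saalschuetz_term n m * y ^ n)"
  define r where "r m = ramanujan_coeff m * (y\<^sup>2 / (1 - 16 * y) ^ 3) ^ m *
      (\<alpha> + 2 * \<beta> * real m + \<beta> * (3 * real m + 1/2) * (16 * y) / (1 - 16 * y))" for m
  let ?T = "Sigma UNIV (\<lambda>n::nat. {m. 2 * m \<le> n})"
  have pos: "0 < 1 - 16 * y" using y by simp
  have f_shift: "f (2 * m + k, m) = ramanujan_coeff m * (y\<^sup>2) ^ m *
      ((\<alpha> + 2 * \<beta> * real m + \<beta> * real k) * (pochhammer (3 * real m + 1/2) k / fact k * (16 * y) ^ k))"
    for m k
    unfolding f_def case_prod_conv saalschuetz_term_shift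
    by (simp add: power_add power_mult power_mult_distrib) algebra
  have f_nonneg: "f (n, m) \<ge> 0" if "2 * m \<le> n" for n m
  proof -
    from that obtain k where "n = 2 * m + k" by (auto simp: le_iff_add)
    then show ?thesis
      using y nonneg by (simp only: f_shift) (simp add: ramanujan_coeff_def pochhammer_nonneg)
  qed
  \<comment> \<open>Summing by rows gives the series in \<open>(2n choose n)^3\<close>; summing the same family along
    \<open>n = 2m + k\<close> with fixed \<open>m\<close> gives the series in \<open>ramanujan_coeff m\<close>.\<close>
  have row: "((\<lambda>m. f (n, m)) has_sum (\<alpha> + \<beta> * real n) * real ((2 * n) choose n) ^ 3 * y ^ n)
      {m. 2 * m \<le> n}" for n
  proof -
    have sub: "{m. 2 * m \<le> n} \<subseteq> {..n}" by auto
    then have fin: "finite {m. 2 * m \<le> n}" by (rule finite_subset) simp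
    have "(\<Sum>m | 2 * m \<le> n. f (n, m)) = (\<Sum>m\<le>n. f (n, m))"
      using sub by (intro sum.mono_neutral_left) (auto simp: f_def saalschuetz_term_eq_0)
    also have "\<dots> = (\<alpha> + \<beta> * real n) * real ((2 * n) choose n) ^ 3 * y ^ n"
      by (simp add: f_def choose_cubed_eq_sum_saalschuetz sum_distrib_left sum_distrib_right)
    finally show ?thesis using has_sum_finite[OF fin, of "\<lambda>m. f (n, m)"] by simp
  qed
  have total: "((\<lambda>n. (\<alpha> + \<beta> * real n) * real ((2 * n) choose n) ^ 3 * y ^ n) has_sum S) UNIV"
    using sums y nonneg by (intro sums_nonneg_imp_has_sum) auto
  have "f summable_on ?T"
    by (rule summable_on_SigmaI[OF row]) (use total f_nonneg in \<open>auto simp: summable_on_def\<close>)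
  then have "(f has_sum S) ?T"
    by (intro has_sum_SigmaI[OF row total])
  then have "((\<lambda>(m, k). f (2 * m + k, m)) has_sum S) (UNIV \<times> UNIV)"
    by (subst has_sum_reindex_bij_witness[of _ "\<lambda>(n, m). (m, n - 2 * m)" "\<lambda>(m, k). (2 * m + k, m)"
          ?T f _ S]) auto
  moreover have "((\<lambda>k. (\<lambda>(m, k). f (2 * m + k, m)) (m, k)) has_sum r m / sqrt (1 - 16 * y)) UNIV"
    for m
  proof -
    let ?s = "3 * real m + 1/2"
    have "(1 - 16 * y) powr (- ?s) = 1 / ((1 - 16 * y) ^ 3) ^ m / sqrt (1 - 16 * y)"
    proof -
      have "(1 - 16 * y) powr (- ?s) = 1 / ((1 - 16 * y) powr (real (3 * m)) * (1 - 16 * y) powr (1/2))"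
        by (simp only: powr_minus_divide powr_add[symmetric] of_nat_mult of_nat_numeral)
      also have "\<dots> = 1 / ((1 - 16 * y) ^ (3 * m) * sqrt (1 - 16 * y))"
        using pos by (simp only: powr_realpow powr_half_sqrt)
      finally show ?thesis by (simp add: power_mult)
    qed
    then have "(\<lambda>k. f (2 * m + k, m)) sums (r m / sqrt (1 - 16 * y))"
      using sums_mult[OF negative_binomial_affine_sums[of "16 * y" "\<alpha> + 2 * \<beta> * real m" \<beta> ?s],
          of "ramanujan_coeff m * (y\<^sup>2) ^ m"] y
      unfolding f_shift by (simp add: r_def power_divide mult_ac)
    then have "((\<lambda>k. f (2 * m + k, m)) has_sum r m / sqrt (1 - 16 * y)) UNIV"
      by (rule sums_nonneg_imp_has_sum) (simp add: f_nonneg)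
    then show ?thesis by simp
  qed
  ultimately have "((\<lambda>m. r m / sqrt (1 - 16 * y)) has_sum S) UNIV"
    by (rule has_sum_SigmaD)
  from sums_mult2[OF has_sum_imp_sums[OF this], of "sqrt (1 - 16 * y)"]
  show ?thesis using pos by (simp add: r_def)
qed

text \<open>
At \<open>y = 1 / 4096\<close> one has \<open>1 - 16y = 255 / 256\<close>, so the new argument
\<open>y^2 / (1 - 16y)^3\<close> is \<open>1 / 255^3\<close>, and the weight \<open>5 + 42n\<close> turns into a multiple of
\<open>8 + 133m\<close>.
\<close>
theorem mainTheorem4:
  shows "summable (\<lambda>n::nat. (fact (6 * n) :: real) / (fact (3 * n) * fact n ^ 3)
            * ((8 + 7 * 19 * real n) / 255 ^ (3 * n)))
    \<and> 1 / pi = 18 / 85 * sqrt (3 / 85) *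
        (\<Sum>n::nat. (fact (6 * n) :: real) / (fact (3 * n) * fact n ^ 3)
            * ((8 + 7 * 19 * real n) / 255 ^ (3 * n)))"
proof -
  let ?t = "\<lambda>n::nat. (fact (6 * n) :: real) / (fact (3 * n) * fact n ^ 3)
            * ((8 + 7 * 19 * real n) / 255 ^ (3 * n))"
  have "(\<lambda>n. (5 + 42 * real n) * real ((2 * n) choose n) ^ 3 * (1 / 4096) ^ n) sums (16 / pi)"
    using ramanujan_sums_42 by (simp add: power_divide mult_ac add_ac)
  from central_binomial_cubes_transformation[OF _ _ _ _ this]
  have "(\<lambda>m. ramanujan_coeff m * ((1 / 4096)\<^sup>2 / (1 - 16 * (1 / 4096)) ^ 3) ^ m *
      (5 + 2 * 42 * real m + 42 * (3 * real m + 1/2) * (16 * (1 / 4096)) / (1 - 16 * (1 / 4096))))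
     sums (16 / pi * sqrt (1 - 16 * (1 / 4096)))"
    by simp
  moreover have "ramanujan_coeff m * ((1 / 4096)\<^sup>2 / (1 - 16 * (1 / 4096)) ^ 3) ^ m *
      (5 + 2 * 42 * real m + 42 * (3 * real m + 1/2) * (16 * (1 / 4096)) / (1 - 16 * (1 / 4096)))
     = 54 / 85 * ?t m" for m
  proof -
    have "(1 / 4096)\<^sup>2 / (1 - 16 * (1 / 4096)) ^ 3 = (1 / 255 ^ 3 :: real)"
      by (simp add: power_divide)
    moreover have "5 + 2 * 42 * real m + 42 * (3 * real m + 1/2) * (16 * (1 / 4096)) / (1 - 16 * (1 / 4096))
        = 54 / 85 * (8 + 7 * 19 * real m)"
      by (simp add: field_simps)
    moreover have "c * (1 / q) ^ m * (54 / 85 * w) = 54 / 85 * (c * (w / q ^ m))" for c q w :: real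
      by (simp add: power_one_over)
    ultimately show ?thesis
      by (simp only: ramanujan_coeff_def power_mult)
  qed
  moreover have "sqrt (1 - 16 * (1 / 4096)) = sqrt 255 / 16"
  proof -
    have "sqrt 256 = (16 :: real)" by (rule real_sqrt_unique) auto
    then show ?thesis by (simp add: real_sqrt_divide)
  qed
  ultimately have "(\<lambda>m. 54 / 85 * ?t m) sums (16 / pi * (sqrt 255 / 16))"
    by (simp only:)
  from sums_mult[OF this, of "85 / 54"]
  have t: "?t sums (85 / 54 * (sqrt 255 / pi))" by simp
  have "sqrt (3 / 85) * sqrt 255 = (3 :: real)"
  proof -
    have "sqrt (3 / 85) * sqrt 255 = sqrt (3 / 85 * 255 :: real)" by (rule real_sqrt_mult[symmetric])
    also have "\<dots> = 3" by (rule real_sqrt_unique) auto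
    finally show ?thesis .
  qed
  then have "1 / pi = 18 / 85 * sqrt (3 / 85) * (85 / 54 * (sqrt 255 / pi))"
    by (simp add: field_simps)
  with t show ?thesis by (simp add: sums_iff)
qed

end
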